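(* For every prime $p$, the cyclic group $\mathbb{Z}_p$ is $(p-1)$-close: for every finite loopless matroid $M=(E,\mathcal{I})$, every labeling $\ell:E\to\mathbb{Z}_p$ and every $g\in\mathbb{Z}_p$ for which there exists a base $B$ with $\sum_{e\in B}\ell(e)=g$, every base $A$ of $M$ has a base $B$ with $\sum_{e\in B}\ell(e)=g$ and $|A\setminus B|\le p-1$.
   Context: $\mathbb{Z}_p$ denotes the integers modulo $p$ under addition. *)

theory Defs
  imports "HOL-Algebra.Elementary_Groups" "HOL-Algebra.FiniteProduct"
    "HOL-Computational_Algebra.Primes"
begin

locale finite_matroid =
  fixes E :: "'e set" and indep :: "'e set \<Rightarrow> bool"
  assumes finite_ground: "finite E"
    and indep_subset_ground: "indep X \<Longrightarrow> X \<subseteq> E"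
    and indep_empty: "indep {}"
    and indep_subset: "indep X \<Longrightarrow> Y \<subseteq> X \<Longrightarrow> indep Y"
    and indep_augment: "indep X \<Longrightarrow> indep Y \<Longrightarrow> card X < card Y \<Longrightarrow>
      \<exists>y\<in>Y - X. indep (insert y X)"

definition loopless :: "'e set \<Rightarrow> ('e set \<Rightarrow> bool) \<Rightarrow> bool"
  where "loopless E indep \<longleftrightarrow> (\<forall>e\<in>E. indep {e})"

definition matroid_base :: "('e set \<Rightarrow> bool) \<Rightarrow> 'e set \<Rightarrow> bool"
  where "matroid_base indep B \<longleftrightarrow> indep B \<and> (\<forall>X. indep X \<and> B \<subseteq> X \<longrightarrow> X = B)"

text \<open>
  The notion is meant for an abelian group \<open>G\<close>. HOL-Algebra groups are written multiplicatively,
  so the label sum of a base is a \<^const>\<open>finprod\<close>. A definition cannot quantify over types, hence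
  the argument of type \<open>'e itself\<close> naming the type of the matroid elements.
\<close>

definition k_close :: "'e itself \<Rightarrow> ('a, 'b) monoid_scheme \<Rightarrow> nat \<Rightarrow> bool"
  where "k_close (_ :: 'e itself) G k \<longleftrightarrow>
    (\<forall>(E :: 'e set) indep (l :: 'e \<Rightarrow> 'a) g.
      finite_matroid E indep \<longrightarrow> loopless E indep \<longrightarrow>
      l \<in> E \<rightarrow> carrier G \<longrightarrow> g \<in> carrier G \<longrightarrow>
      (\<exists>B. matroid_base indep B \<and> finprod G l B = g) \<longrightarrow>
      (\<forall>A. matroid_base indep A \<longrightarrow>
        (\<exists>B. matroid_base indep B \<and> finprod G l B = g \<and> card (A - B) \<le> k)))"

lemma finprod_integer_mod_group:
  assumes "finite B" "n > 0" "l \<in> B \<rightarrow> carrier (integer_mod_group n)"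
  shows "finprod (integer_mod_group n) l B = (\<Sum>e\<in>B. l e) mod int n"
proof -
  interpret comm_group "integer_mod_group n"
    by simp
  show ?thesis
    using assms
  proof (induction B rule: finite_induct)
    case (insert x F)
    then have "l \<in> F \<rightarrow> carrier (integer_mod_group n)" "l x \<in> carrier (integer_mod_group n)"
      by auto
    with insert show ?case
      by (simp add: finprod_insert mod_add_right_eq)
  qed simp
qed

end

theory Submission
  imports Defs "HOL-Number_Theory.Cong"
begin

text \<open>
  Let \<open>B\<close> be a base with the prescribed label sum closest to \<open>A\<close>, and suppose \<open>|A - B| = d \<ge> p\<close>.
  Contract \<open>A \<inter> B\<close>. No element of \<open>B - A\<close> can be exchanged for an element of \<open>A - B\<close> with the same
  label, so every colour class inside \<open>A \<union> B\<close> is independent in the contraction. Delete some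
  \<open>e \<in> B - A\<close>: the ranks of the colour classes now add up to \<open>2 d - 1\<close>, and the rank is still \<open>d\<close>.
  The Schrijver--Seymour bound (at least \<open>min p (\<Sum>\<^sub>g r(E\<^sub>g) - r(E) + 1)\<close> label sums of bases) shows
  that all of \<open>\<int>\<^sub>p\<close> occurs. In particular the sum of \<open>B\<close> is attained by a base that avoids \<open>e\<close> and is
  therefore closer to \<open>A\<close>.
\<close>

section \<open>The Cauchy--Davenport theorem\<close>

text \<open>Residues are the integers in \<open>{0..<int p}\<close>, as in the carrier of
  \<open>integer_mod_group p\<close>, so labels need no conversion.\<close>

definition mod_sumset :: "nat \<Rightarrow> int set \<Rightarrow> int set \<Rightarrow> int set"
  where "mod_sumset p A B = (\<lambda>(a, b). (a + b) mod int p) ` (A \<times> B)"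

lemma finite_mod_sumset: "finite A \<Longrightarrow> finite B \<Longrightarrow> finite (mod_sumset p A B)"
  by (simp add: mod_sumset_def)

lemma inj_on_add_mod: "inj_on (\<lambda>x. (x + c) mod int p) {0..<int p}"
proof (rule inj_onI)
  fix x y assume xy: "x \<in> {0..<int p}" "y \<in> {0..<int p}" "(x + c) mod int p = (y + c) mod int p"
  then have "(x + c - c) mod int p = (y + c - c) mod int p"
    by (metis mod_diff_left_eq)
  with xy show "x = y" by simp
qed

text \<open>Modulo a prime, \<open>d\<close> is invertible, so adding multiples of \<open>d\<close>
  to a single element of \<open>A\<close> already reaches every residue.\<close>

lemma translation_invariant_residues:
  fixes A :: "int set"
  assumes p: "prime p" and A: "A \<subseteq> {0..<int p}" "A \<noteq> {}" and d: "\<not> int p dvd d"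
    and inv: "\<And>a. a \<in> A \<Longrightarrow> (a + d) mod int p \<in> A"
  shows "A = {0..<int p}"
proof -
  from A obtain a where a: "a \<in> A" by auto
  have multiples: "(a + int n * d) mod int p \<in> A" for n
  proof (induction n)
    case 0
    show ?case using a A by auto
  next
    case (Suc n)
    from inv[OF this] show ?case
      by (simp add: mod_add_left_eq mod_add_right_eq algebra_simps)
  qed
  have "coprime d (int p)"
    using p d by (metis coprime_commute prime_imp_coprime prime_nat_int_transfer)
  then obtain u where u: "[d * u = 1] (mod int p)"
    using cong_solve_coprime_int by blast
  have "x \<in> A" if x: "x \<in> {0..<int p}" for x
  proof -
    \<comment> \<open>\<open>u\<close> inverts \<open>d\<close>, so \<open>n\<close> solves
      \<open>n * d = x - a\<close> modulo \<open>p\<close>; reducing modulo \<open>p\<close> makes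
      it a natural number.\<close>
    define n where "n = nat (((x - a) * u) mod int p)"
    have "0 < p" using p prime_gt_0_nat by blast
    then have n: "int n = ((x - a) * u) mod int p" by (simp add: n_def)
    have "[int n * d = (x - a) * u * d] (mod int p)"
      by (simp add: n cong_def mod_mult_left_eq)
    also have "[(x - a) * u * d = (x - a) * 1] (mod int p)"
      using cong_scalar_left[OF u, of "x - a"] by (simp add: mult_ac)
    finally have "[a + int n * d = a + (x - a)] (mod int p)"
      by (intro cong_add) auto
    then have "(a + int n * d) mod int p = x"
      using x by (simp add: cong_def)
    with multiples[of n] show ?thesis by simp
  qed
  with A show ?thesis by blast
qed

text \<open>Dyson's transform moves elements from \<open>B\<close> into a translate joined to
  \<open>A\<close>. It preserves the total of the two sizes and does not enlarge the sumset, so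
  induction on \<open>card B\<close> applies.\<close>

theorem cauchy_davenport:
  assumes p: "prime p"
    and "A \<subseteq> {0..<int p}" "A \<noteq> {}" "B \<subseteq> {0..<int p}" "B \<noteq> {}"
  shows "min p (card A + card B - 1) \<le> card (mod_sumset p A B)"
  using assms(2-)
proof (induction "card B" arbitrary: A B rule: less_induct)
  case less
  have fin: "finite A" "finite B"
    using less.prems finite_subset by blast+
  from less.prems obtain b' where b': "b' \<in> B" by auto
  have "(\<lambda>x. (x + b') mod int p) ` A \<subseteq> mod_sumset p A B"
    using b' by (auto simp: mod_sumset_def)
  from card_mono[OF finite_mod_sumset[OF fin] this]
  have cardA: "card A \<le> card (mod_sumset p A B)"
    using inj_on_subset[OF inj_on_add_mod less.prems(1)] by (simp add: card_image)
  show ?case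
  proof (cases "B = {b'} \<or> A = {0..<int p}")
    case True
    \<comment> \<open>The bound equals \<open>card A\<close> if \<open>B\<close> is a singleton, and
      is at most \<open>p = card A\<close> if \<open>A\<close> contains all residues.\<close>
    with cardA show ?thesis by auto
  next
    case False
    then obtain b where b: "b \<in> B" "b \<noteq> b'" using b' by auto
    have "\<not> int p dvd b - b'"
    proof
      assume "int p dvd b - b'"
      then have "b mod int p = b' mod int p" by (simp add: mod_eq_dvd_iff)
      moreover have "b \<in> {0..<int p}" "b' \<in> {0..<int p}" using b b' less.prems by blast+
      ultimately show False using b by simp
    qed
    \<comment> \<open>\<open>A\<close> is a proper subset of the residues, so translation by
      \<open>b - b'\<close> moves some \<open>a\<close> out of it.\<close>
    with translation_invariant_residues[OF p less.prems(1,2), of "b - b'"] False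
    obtain a where a: "a \<in> A" "(a + (b - b')) mod int p \<notin> A" by auto
    \<comment> \<open>Dyson's transform by the shift \<open>s\<close>: it keeps \<open>b'\<close> in the smaller set and moves \<open>b\<close> out of it.\<close>
    define s where "s = a - b'"
    define h where "h = (\<lambda>x. (x + s) mod int p)"
    define B' where "B' = {x \<in> B. h x \<in> A}"
    define A' where "A' = A \<union> h ` (B - B')"
    have injh: "inj_on h (B - B')"
      unfolding h_def by (rule inj_on_subset[OF inj_on_add_mod]) (use less.prems in auto)
    have "h b' \<in> A"
      using a less.prems by (auto simp: h_def s_def)
    then have "b' \<in> B'" using b' by (simp add: B'_def)
    have "b \<notin> B'" using a(2) by (simp add: B'_def h_def s_def algebra_simps)
    then have "B' \<subset> B" using b by (auto simp: B'_def)
    then have lt: "card B' < card B" using fin psubset_card_mono by blast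
    have "0 < p" using p prime_gt_0_nat by blast
    then have "A' \<subseteq> {0..<int p}" using less.prems by (auto simp: A'_def h_def)
    then have IH: "min p (card A' + card B' - 1) \<le> card (mod_sumset p A' B')"
      using less.hyps[OF lt, of A'] \<open>b' \<in> B'\<close> \<open>B' \<subset> B\<close> a(1) less.prems
      by (auto simp: A'_def)
    have "A \<inter> h ` (B - B') = {}" by (auto simp: B'_def)
    then have "card A' = card A + card (B - B')"
      unfolding A'_def using fin injh by (simp add: card_Un_disjoint card_image)
    moreover have "card (B - B') = card B - card B'"
      using \<open>B' \<subset> B\<close> fin by (meson card_Diff_subset finite_subset psubset_imp_subset)
    ultimately have sum: "card A' + card B' = card A + card B" using lt by simp
    have "mod_sumset p A' B' \<subseteq> mod_sumset p A B"
    proof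
      fix z assume "z \<in> mod_sumset p A' B'"
      then obtain x y where xy: "x \<in> A'" "y \<in> B'" "z = (x + y) mod int p"
        by (auto simp: mod_sumset_def)
      show "z \<in> mod_sumset p A B"
      proof (cases "x \<in> A")
        case True
        with xy show ?thesis by (auto simp: mod_sumset_def B'_def)
      next
        case False
        then obtain v where v: "v \<in> B" "x = h v" using xy by (auto simp: A'_def)
        \<comment> \<open>The shift \<open>s\<close> passes from \<open>v\<close> to
          \<open>y\<close>, and \<open>h\<close> maps \<open>B'\<close> into
          \<open>A\<close>.\<close>
        have "z = (h y + v) mod int p"
          by (simp add: xy v h_def mod_simps add_ac)
        moreover have "h y \<in> A" using xy by (simp add: B'_def)
        ultimately show ?thesis using v by (auto simp: mod_sumset_def)
      qed
    qed
    from card_mono[OF finite_mod_sumset[OF fin] this] IH sum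
    show ?thesis by simp
  qed
qed

section \<open>Rank and bases\<close>

definition matroid_rank :: "('e set \<Rightarrow> bool) \<Rightarrow> 'e set \<Rightarrow> nat"
  where "matroid_rank indep X = Max (card ` {Y. indep Y \<and> Y \<subseteq> X})"

context finite_matroid
begin

abbreviation "rk \<equiv> matroid_rank indep"

lemma indep_finite: "indep X \<Longrightarrow> finite X"
  using finite_ground finite_subset indep_subset_ground by blast

lemma finite_indep_sets: "finite {Y. indep Y \<and> P Y}"
  by (rule finite_subset[of _ "Pow E"]) (use finite_ground indep_subset_ground in auto)

lemma card_le_rank: "indep Y \<Longrightarrow> Y \<subseteq> X \<Longrightarrow> card Y \<le> rk X"
  unfolding matroid_rank_def by (rule Max_ge) (auto intro: finite_indep_sets)

lemma rank_witness: obtains Y where "indep Y" "Y \<subseteq> X" "card Y = rk X"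
proof -
  have "rk X \<in> card ` {Y. indep Y \<and> Y \<subseteq> X}"
    unfolding matroid_rank_def
    by (rule Max_in) (use indep_empty in \<open>auto intro: finite_indep_sets\<close>)
  with that show ?thesis by auto
qed

lemma rank_mono: "X \<subseteq> Y \<Longrightarrow> rk X \<le> rk Y"
  by (metis card_le_rank order_trans rank_witness)

lemma rank_insert_le: "rk (insert e X) \<le> rk X + 1"
proof -
  obtain Y where Y: "indep Y" "Y \<subseteq> insert e X" "card Y = rk (insert e X)"
    by (rule rank_witness)
  have "indep (Y - {e})" "Y - {e} \<subseteq> X"
    using Y indep_subset by auto
  from card_le_rank[OF this] Y show ?thesis
    using card_Diff1_le[of Y e] by (cases "e \<in> Y") (auto simp: card_Diff_singleton)
qed

text \<open>Iterated augmentation. Drawing the new elements from \<open>K\<close> lets the exchange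
  arguments control where they lie.\<close>

lemma indep_extend:
  assumes "indep J" "indep K" "card J \<le> card K"
  obtains L where "L \<subseteq> K - J" "indep (J \<union> L)" "card (J \<union> L) = card K"
  using assms
proof (induction "card K - card J" arbitrary: J thesis)
  case 0
  show ?case by (rule 0(2)[of "{}"]) (use 0 in auto)
next
  case (Suc n)
  then have "card J < card K" by simp
  with Suc.prems indep_augment obtain y where y: "y \<in> K - J" "indep (insert y J)" by blast
  have c: "card (insert y J) = Suc (card J)"
    using y Suc.prems indep_finite by simp
  have "n = card K - card (insert y J)" "card (insert y J) \<le> card K"
    using Suc(2) c by auto
  from Suc(1)[OF this(1) _ y(2) Suc.prems(3) this(2)] obtain L where
    L: "L \<subseteq> K - insert y J" "indep (insert y J \<union> L)" "card (insert y J \<union> L) = card K"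
    by blast
  show ?case by (rule Suc.prems(1)[of "insert y L"]) (use y L in auto)
qed

lemma base_iff_card: "matroid_base indep B \<longleftrightarrow> indep B \<and> card B = rk E"
proof
  assume B: "matroid_base indep B"
  then have iB: "indep B" by (simp add: matroid_base_def)
  obtain Y where Y: "indep Y" "Y \<subseteq> E" "card Y = rk E" by (rule rank_witness)
  have le: "card B \<le> card Y"
    using card_le_rank[OF iB indep_subset_ground[OF iB]] Y by simp
  from indep_extend[OF iB Y(1) le] obtain L where
    "indep (B \<union> L)" "card (B \<union> L) = card Y" by metis
  with B Y iB show "indep B \<and> card B = rk E"
    unfolding matroid_base_def by (metis Un_upper1)
next
  assume B: "indep B \<and> card B = rk E"
  show "matroid_base indep B"
    unfolding matroid_base_def
  proof (intro conjI allI impI)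
    fix X assume X: "indep X \<and> B \<subseteq> X"
    then have "card X \<le> card B"
      using B card_le_rank indep_subset_ground by metis
    with X show "X = B"
      using card_seteq indep_finite by metis
  qed (use B in simp)
qed

lemma indep_extend_base:
  assumes "indep I"
  obtains B where "matroid_base indep B" "I \<subseteq> B"
proof -
  obtain Y where Y: "indep Y" "Y \<subseteq> E" "card Y = rk E" by (rule rank_witness)
  have "card I \<le> card Y" using assms Y card_le_rank indep_subset_ground by metis
  from indep_extend[OF assms Y(1) this] obtain L where
    "indep (I \<union> L)" "card (I \<union> L) = card Y" by metis
  with Y that show ?thesis by (metis Un_upper1 base_iff_card)
qed

text \<open>If \<open>X\<close> lies in the closure of \<open>Z\<close>, then \<open>Y\<close> is independent over \<open>Z \<union> X\<close> as soon as it is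
  over \<open>Z\<close>.\<close>

lemma indep_Un_over_closure:
  assumes Z: "indep (Z \<union> Y)" "Z \<inter> Y = {}"
    and X: "\<And>x. x \<in> X - Z \<Longrightarrow> \<not> indep (insert x Z)"
    and J: "indep J" "J \<subseteq> Z \<union> X"
  shows "indep (J \<union> Y)"
proof -
  have iZ: "indep Z" using Z indep_subset by blast
  \<comment> \<open>Augmenting \<open>Z\<close> from a larger \<open>K\<close> would add an element
    of \<open>X - Z\<close>.\<close>
  have bound: "card K \<le> card Z" if K: "indep K" "K \<subseteq> Z \<union> X" for K
    using indep_augment[OF iZ K(1)] X K(2) by (meson DiffD1 DiffD2 DiffI UnE not_le subsetD)
  from indep_extend[OF J(1) iZ bound[OF J]] obtain L where
    L: "L \<subseteq> Z - J" "indep (J \<union> L)" "card (J \<union> L) = card Z" by blast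
  have fin: "finite Z" "finite Y" using Z(1) indep_finite by auto
  have cZY: "card (Z \<union> Y) = card Z + card Y"
    using fin Z(2) by (simp add: card_Un_disjoint)
  with L have "card (J \<union> L) \<le> card (Z \<union> Y)" by simp
  from indep_extend[OF L(2) Z(1) this] obtain N where
    N: "N \<subseteq> Z \<union> Y - (J \<union> L)" "indep (J \<union> L \<union> N)" "card (J \<union> L \<union> N) = card (Z \<union> Y)"
    by blast
  have finN: "finite (J \<union> L)" "finite N" using N(2) indep_finite by auto
  \<comment> \<open>By \<open>bound\<close>, \<open>J \<union> L\<close> has maximal size within
    \<open>Z \<union> X\<close>, so \<open>N\<close> lies in \<open>Y\<close>; counting then gives
    \<open>N = Y\<close>.\<close>
  have "N \<inter> Z = {}"
  proof (rule ccontr)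
    assume "N \<inter> Z \<noteq> {}"
    then obtain z where z: "z \<in> N" "z \<in> Z" by auto
    then have "indep (insert z (J \<union> L))" "insert z (J \<union> L) \<subseteq> Z \<union> X"
      using N(2) L(1) J(2) by (auto elim!: indep_subset)
    moreover have "z \<notin> J \<union> L" using N(1) z by auto
    then have "card (insert z (J \<union> L)) = Suc (card Z)"
      using L(3) finN(1) by (simp del: Un_iff)
    ultimately show False using bound[of "insert z (J \<union> L)"] by simp
  qed
  then have "N \<subseteq> Y" using N(1) by auto
  moreover have "card (J \<union> L \<union> N) = card (J \<union> L) + card N"
    by (rule card_Un_disjoint) (use finN N(1) in auto)
  then have "card N = card Y" using N(3) L(3) cZY by simp
  ultimately have "N = Y" using fin card_subset_eq by blast
  with N(2) show ?thesis by (auto elim!: indep_subset)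
qed

section \<open>Label sums of bases\<close>

text \<open>If no element of \<open>C\<close> can replace \<open>e\<close>, then \<open>C\<close>
  lies in the closure of \<open>B - {e}\<close>. A maximum independent subset of
  \<open>I \<union> C\<close> then stays independent when \<open>e\<close> is added, so
  \<open>e\<close> would raise the rank.\<close>

lemma base_exchange_label:
  assumes B: "matroid_base indep B" "insert e I \<subseteq> B" "e \<notin> I"
    and C: "rk (insert e (I \<union> C)) = rk (I \<union> C)"
  obtains x where "x \<in> C" "x \<notin> B - {e}" "matroid_base indep (insert x (B - {e}))"
proof (cases "\<exists>x \<in> C - (B - {e}). indep (insert x (B - {e}))")
  case True
  then obtain x where x: "x \<in> C" "x \<notin> B - {e}" "indep (insert x (B - {e}))" by auto
  have "finite B" using B indep_finite base_iff_card by blast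
  then have "card (insert x (B - {e})) = card B"
    using x B(2) card_Suc_Diff1[of B e] by auto
  with x B that show ?thesis by (metis base_iff_card)
next
  case False
  have iB: "indep B" using B base_iff_card by blast
  obtain Y where Y: "indep Y" "Y \<subseteq> I \<union> C" "card Y = rk (I \<union> C)" by (rule rank_witness)
  have "B - {e} \<union> {e} = B" using B(2) by auto
  then have *: "indep (B - {e} \<union> {e})" using iB by simp
  have "Y \<subseteq> (B - {e}) \<union> C" using Y(2) B by auto
  from indep_Un_over_closure[OF * _ _ Y(1) this] False
  have ins: "indep (insert e Y)" by auto
  have "e \<notin> C"
  proof
    assume "e \<in> C"
    with False * show False by (metis Diff_iff Un_insert_right insertI1 sup_bot_right)
  qed
  with Y(2) B(3) have "e \<notin> Y" by auto
  with card_le_rank[OF ins, of "insert e (I \<union> C)"] Y C indep_finite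
  show ?thesis by auto
qed

text \<open>The theorem of Schrijver and Seymour for the contraction of the matroid by \<open>I\<close>. If \<open>e\<close> is
  contracted in addition, the bound drops by one less than the number of colour classes spanning
  \<open>e\<close>. By exchange, \<open>e\<close> may be replaced by an element of any of these classes, so Cauchy--Davenport
  makes up for the loss.\<close>

theorem base_label_sums:
  assumes p: "prime p" and l: "l ` E \<subseteq> {0..<int p}" and "indep I"
  shows "min (int p) (1 + (\<Sum>g\<in>{0..<int p}. int (rk (I \<union> {x \<in> E. l x = g})) - int (card I))
      - (int (rk E) - int (card I)))
    \<le> int (card ((\<lambda>B. sum l (B - I) mod int p) ` {B. matroid_base indep B \<and> I \<subseteq> B}))"
  using \<open>indep I\<close>
proof (induction "rk E - card I" arbitrary: I)
  case 0
  \<comment> \<open>Here \<open>I\<close> is a base and no class adds rank to it, so the bound is at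
    most 1, and \<open>I\<close> itself provides one sum.\<close>
  have iE: "card I \<le> rk E" using 0 card_le_rank indep_subset_ground by metis
  with 0 have cI: "card I = rk E" by simp
  then have base: "matroid_base indep I" using 0 base_iff_card by simp
  have "rk (I \<union> {x \<in> E. l x = g}) \<le> rk E" for g
    using indep_subset_ground[OF 0(2)] by (intro rank_mono) auto
  then have "(\<Sum>g\<in>{0..<int p}. int (rk (I \<union> {x \<in> E. l x = g})) - int (card I)) \<le> 0"
    using cI by (intro sum_nonpos) simp
  moreover have "0 < card ((\<lambda>B. sum l (B - I) mod int p) ` {B. matroid_base indep B \<and> I \<subseteq> B})"
    using base by (auto simp: card_gt_0_iff matroid_base_def intro: finite_indep_sets)
  ultimately show ?case using cI by simp
next
  case (Suc n)
  define S where "S = (\<lambda>I. (\<lambda>B. sum l (B - I) mod int p) ` {B. matroid_base indep B \<and> I \<subseteq> B})"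
  define C where "C = (\<lambda>g. {x \<in> E. l x = g})"
  \<comment> \<open>\<open>1 + f I\<close> is the Schrijver--Seymour bound for the contraction by
    \<open>I\<close>.\<close>
  define f where "f = (\<lambda>I. (\<Sum>g\<in>{0..<int p}. int (rk (I \<union> C g)) - int (card I))
      - (int (rk E) - int (card I)))"
  have p0: "0 < p" using p prime_gt_0_nat by blast
  have finS: "finite (S I)" for I
    unfolding S_def matroid_base_def by (intro finite_imageI) (simp add: finite_indep_sets)
  have ltI: "card I < rk E" using Suc(2) by simp
  from indep_extend_base[OF Suc.prems] obtain D where D: "matroid_base indep D" "I \<subseteq> D" .
  with ltI have "D \<noteq> I" by (auto simp: base_iff_card)
  with D obtain e where e: "e \<in> D" "e \<notin> I" by auto
  have iI: "indep (insert e I)"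
    using D e indep_subset[of D] by (simp add: base_iff_card)
  have cI: "card (insert e I) = card I + 1"
    using e Suc.prems indep_finite by simp
  have eE: "e \<in> E" using iI indep_subset_ground by auto
  \<comment> \<open>The colours whose class spans \<open>e\<close> over \<open>I\<close>; the colour
    of \<open>e\<close> is one of them.\<close>
  define K where "K = {g \<in> {0..<int p}. rk (insert e (I \<union> C g)) = rk (I \<union> C g)}"
  have "l e \<in> K"
    using l eE by (auto simp: K_def C_def insert_absorb)
  have KZ: "K \<subseteq> {0..<int p}" "S (insert e I) \<subseteq> {0..<int p}"
    using p0 by (auto simp: K_def S_def)
  have "S (insert e I) \<noteq> {}"
    using indep_extend_base[OF iI] by (auto simp: S_def)
  then have CD: "min p (card (S (insert e I)) + card K - 1) \<le> card (mod_sumset p (S (insert e I)) K)"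
    using cauchy_davenport[OF p] KZ \<open>l e \<in> K\<close> by blast
  \<comment> \<open>Sums in \<open>S (insert e I)\<close> omit the label of \<open>e\<close>;
    exchanging \<open>e\<close> for an element labelled \<open>g\<close> in \<open>K\<close>
    supplies \<open>g\<close> instead.\<close>
  have "mod_sumset p (S (insert e I)) K \<subseteq> S I"
  proof
    fix z assume "z \<in> mod_sumset p (S (insert e I)) K"
    then obtain B g where B: "matroid_base indep B" "insert e I \<subseteq> B" and g: "g \<in> K"
      and z: "z = (sum l (B - insert e I) mod int p + g) mod int p"
      by (auto simp: mod_sumset_def S_def)
    have "rk (insert e (I \<union> C g)) = rk (I \<union> C g)"
      using g by (simp add: K_def)
    from base_exchange_label[OF B e(2) this] obtain x where
      x: "x \<in> C g" "x \<notin> B - {e}" "matroid_base indep (insert x (B - {e}))" .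
    have "finite B" using B base_iff_card indep_finite by blast
    have "x \<notin> I" using x(2) B(2) e(2) by auto
    then have "insert x (B - {e}) - I = insert x (B - insert e I)" by auto
    moreover have "x \<notin> B - insert e I" using x(2) by auto
    ultimately have "sum l (insert x (B - {e}) - I) = g + sum l (B - insert e I)"
      using \<open>finite B\<close> x(1) by (simp add: C_def)
    then have "z = sum l (insert x (B - {e}) - I) mod int p"
      by (simp add: z mod_add_left_eq algebra_simps mod_add_right_eq)
    moreover have "I \<subseteq> insert x (B - {e})" using B(2) e(2) by auto
    ultimately show "z \<in> S I" using x(3) by (auto simp: S_def)
  qed
  with CD have CD': "min p (card (S (insert e I)) + card K - 1) \<le> card (S I)"
    using card_mono[OF finS] order_trans by blast
  have "0 < card K"
    using \<open>l e \<in> K\<close> KZ finite_subset by (auto simp: card_gt_0_iff)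
  \<comment> \<open>Contracting \<open>e\<close> lowers the contracted rank of a class by one if its
    colour is in \<open>K\<close>, and leaves it unchanged otherwise.\<close>
  have summand: "int (rk (insert e I \<union> C g)) - int (card (insert e I))
      = int (rk (I \<union> C g)) - int (card I) - (if g \<in> K then 1 else 0)"
    if "g \<in> {0..<int p}" for g
  proof -
    have "rk (I \<union> C g) \<le> rk (insert e (I \<union> C g))" by (rule rank_mono) auto
    with rank_insert_le[of e "I \<union> C g"] that cI show ?thesis by (auto simp: K_def)
  qed
  have "(\<Sum>g\<in>{0..<int p}. int (rk (insert e I \<union> C g)) - int (card (insert e I)))
      = (\<Sum>g\<in>{0..<int p}. int (rk (I \<union> C g)) - int (card I))
        - (\<Sum>g\<in>{0..<int p}. if g \<in> K then 1 else 0)"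
    unfolding sum_subtractf[symmetric] using summand by (intro sum.cong) auto
  also have "(\<Sum>g\<in>{0..<int p}. if g \<in> K then 1 else 0) = int (card K)"
    using KZ(1) by (simp add: sum.If_cases Int_absorb1)
  \<comment> \<open>The \<open>+ 1\<close> comes from the drop of \<open>rk E - card I\<close>. The
    net loss \<open>card K - 1\<close> is what \<open>CD'\<close> recovers.\<close>
  finally have "f (insert e I) = f I - int (card K) + 1"
    using cI by (simp add: f_def)
  moreover have "min (int p) (1 + f (insert e I)) \<le> int (card (S (insert e I)))"
    using Suc(1)[OF _ iI] Suc(2) cI by (simp add: f_def S_def C_def algebra_simps)
  ultimately have "min (int p) (1 + f I) \<le> int (card (S I))"
    using CD' \<open>0 < card K\<close> by linarith
  then show ?case by (simp add: f_def S_def C_def algebra_simps)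
qed

section \<open>Closest bases\<close>

text \<open>Within one colour, trading an element of \<open>B - A\<close> for one of
  \<open>A - B\<close> keeps the sum and moves \<open>B\<close> closer to \<open>A\<close>. As this
  is excluded, \<open>X\<close> lies in the closure of \<open>Z\<close>, and \<open>Y\<close> stays
  independent over it. Such trades preserve the integer sum, so \<open>closest\<close> need not
  mention residues.\<close>

lemma closest_base_colour_class_indep:
  fixes l :: "'e \<Rightarrow> int"
  assumes A: "matroid_base indep A" and B: "matroid_base indep B"
    and closest: "\<And>B'. matroid_base indep B' \<Longrightarrow> sum l B' = sum l B \<Longrightarrow> card (A - B) \<le> card (A - B')"
  shows "indep (A \<inter> B \<union> {x \<in> A \<union> B. l x = g})"
proof -
  define X where "X = {x \<in> A - B. l x = g}"
  define Y where "Y = {x \<in> B - A. l x = g}"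
  define Z where "Z = B - Y"
  have iA: "indep A" and iB: "indep B" using A B base_iff_card by auto
  then have fin: "finite A" "finite B" "finite Y" "finite Z"
    by (auto simp: Y_def Z_def indep_finite)
  have ZY: "Z \<union> Y = B" "Z \<inter> Y = {}" by (auto simp: Z_def Y_def)
  have "indep (A \<inter> B \<union> X \<union> Y)"
  proof (rule indep_Un_over_closure)
    show "indep (Z \<union> Y)" "Z \<inter> Y = {}" using iB ZY by auto
    show "indep (A \<inter> B \<union> X)" using iA by (rule indep_subset) (auto simp: X_def)
    show "A \<inter> B \<union> X \<subseteq> Z \<union> X" by (auto simp: Z_def Y_def)
    show "\<not> indep (insert x Z)" if x: "x \<in> X - Z" for x
    proof
      assume ind: "indep (insert x Z)"
      have le: "card (insert x Z) \<le> card B"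
        using card_le_rank[OF ind indep_subset_ground[OF ind]] B base_iff_card by simp
      from indep_extend[OF ind iB le] obtain L where
        L: "L \<subseteq> B - insert x Z" "indep (insert x Z \<union> L)" "card (insert x Z \<union> L) = card B"
        by blast
      \<comment> \<open>\<open>insert x Z \<union> L\<close> arises from \<open>B\<close> by trading
        a single element of \<open>Y\<close> for \<open>x\<close>, both labelled
        \<open>g\<close>.\<close>
      have LY: "L \<subseteq> Y" using L(1) by (auto simp: Z_def)
      then have finL: "finite L" using fin finite_subset by blast
      have "Z \<inter> L = {}" "x \<notin> Z \<union> L" using LY ZY x by (auto simp: X_def Y_def)
      then have "card (insert x Z \<union> L) = 1 + card Z + card L"
        "sum l (insert x Z \<union> L) = l x + sum l Z + sum l L"
        using fin finL by (auto simp: card_Un_disjoint sum.union_disjoint)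
      moreover have "card B = card Z + card Y" "sum l B = sum l Z + sum l Y"
        using card_Un_disjoint[of Z Y] sum.union_disjoint[of Z Y l] fin ZY by auto
      moreover have "sum l Y = (\<Sum>y\<in>Y. g)" "sum l L = (\<Sum>y\<in>L. g)"
        using LY by (intro sum.cong; auto simp: Y_def)+
      moreover have "l x = g" using x by (simp add: X_def)
      ultimately have cY: "card Y = 1 + card L" and
        "sum l (insert x Z \<union> L) = g + sum l Z + int (card L) * g" "sum l B = sum l Z + int (card Y) * g"
        using L(3) by auto
      then have "sum l (insert x Z \<union> L) = sum l B" by (simp add: algebra_simps)
      moreover have "matroid_base indep (insert x Z \<union> L)"
        using L B base_iff_card by simp
      ultimately have "card (A - B) \<le> card (A - (insert x Z \<union> L))"
        using closest by blast
      \<comment> \<open>\<open>Y\<close> avoids \<open>A\<close>, so \<open>Z\<close> keeps all of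
        \<open>A \<inter> B\<close>, while \<open>x\<close> is gained.\<close>
      moreover have "A - (insert x Z \<union> L) \<subset> A - B"
        using x by (auto simp: X_def Z_def Y_def)
      ultimately show False
        using psubset_card_mono[of "A - B"] fin by (meson finite_Diff not_le)
    qed
  qed
  moreover have "A \<inter> B \<union> {x \<in> A \<union> B. l x = g} = A \<inter> B \<union> X \<union> Y"
    by (auto simp: X_def Y_def)
  ultimately show ?thesis by simp
qed

lemma restriction: "E' \<subseteq> E \<Longrightarrow> finite_matroid E' (\<lambda>X. indep X \<and> X \<subseteq> E')"
  using finite_ground indep_empty indep_subset indep_augment
  by unfold_locales (auto intro: finite_subset, blast)

theorem exists_close_base:
  assumes p: "prime p" and l: "l ` E \<subseteq> {0..<int p}"
    and A: "matroid_base indep A" and B0: "matroid_base indep B\<^sub>0"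
  shows "\<exists>B. matroid_base indep B \<and> sum l B mod int p = sum l B\<^sub>0 mod int p \<and> card (A - B) \<le> p - 1"
proof -
  define good where "good = (\<lambda>B. matroid_base indep B \<and> sum l B mod int p = sum l B\<^sub>0 mod int p)"
  have "good B\<^sub>0" using B0 by (simp add: good_def)
  from ex_has_least_nat[of good, OF this, of "\<lambda>B. card (A - B)"] obtain B where
    B: "good B" and least: "\<And>B'. good B' \<Longrightarrow> card (A - B) \<le> card (A - B')" by blast
  have "card (A - B) \<le> p - 1"
  proof (rule ccontr)
    assume far: "\<not> card (A - B) \<le> p - 1"
    have bB: "matroid_base indep B" using B by (simp add: good_def)
    have iA: "indep A" and iB: "indep B" and cAB: "card A = card B"
      using A bB base_iff_card by auto
    have fin: "finite A" "finite B" using iA iB indep_finite by auto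
    have AB: "A \<subseteq> E" "B \<subseteq> E" using iA iB indep_subset_ground by auto
    have p0: "0 < p" using p prime_gt_0_nat by blast
    define I where "I = A \<inter> B"
    define d where "d = card (A - B)"
    have d: "card A = card I + d" "card B = card I + d" "card (B - A) = d"
      using card_Diff_subset_Int[of A B] card_Diff_subset_Int[of B A] card_mono[of A I] fin cAB
      by (auto simp: d_def I_def Int_commute)
    have dp: "p \<le> d" using far d_def by simp
    then have "card (B - A) \<noteq> 0" using d p0 by simp
    then have "B - A \<noteq> {}" by force
    then obtain e where e: "e \<in> B" "e \<notin> A" by blast
    define E' where "E' = A \<union> B - {e}"
    define indep' where "indep' = (\<lambda>X. indep X \<and> X \<subseteq> E')"
    interpret R: finite_matroid E' indep'
      unfolding indep'_def by (rule restriction) (use AB in \<open>auto simp: E'_def\<close>)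
    have iI: "indep' I" and "indep' A"
      using iA e by (auto simp: indep'_def I_def E'_def elim!: indep_subset)
    \<comment> \<open>Deleting \<open>e\<close> keeps the rank because the base \<open>A\<close>
      survives.\<close>
    have rkE': "R.rk E' = card A"
    proof (rule antisym)
      show "card A \<le> R.rk E'"
        using \<open>indep' A\<close> e by (intro R.card_le_rank) (auto simp: E'_def)
      obtain Y where "indep' Y" "card Y = R.rk E'" by (rule R.rank_witness)
      then show "R.rk E' \<le> card A"
        using card_le_rank[of Y E] indep_subset_ground[of Y] A by (simp add: indep'_def base_iff_card)
    qed
    define C where "C = (\<lambda>g. {x \<in> E' - I. l x = g})"
    have rank_class: "int (card (C g)) \<le> int (R.rk (I \<union> {x \<in> E'. l x = g})) - int (card I)" for g
    proof -
      have "indep (A \<inter> B \<union> {x \<in> A \<union> B. l x = g})"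
        by (rule closest_base_colour_class_indep[OF A bB])
          (use least B in \<open>auto simp: good_def\<close>)
      then have "indep' (I \<union> C g)"
        using e by (auto simp: indep'_def I_def C_def E'_def elim!: indep_subset)
      then have "card (I \<union> C g) \<le> R.rk (I \<union> {x \<in> E'. l x = g})"
        by (rule R.card_le_rank) (auto simp: C_def)
      moreover have "card (I \<union> C g) = card I + card (C g)"
        using fin by (intro card_Un_disjoint) (auto simp: C_def E'_def I_def)
      ultimately show ?thesis by simp
    qed
    have "E' - I = (A - B) \<union> (B - A - {e})" using e by (auto simp: E'_def I_def)
    then have "card (E' - I) = d + (d - 1)"
      using card_Un_disjoint[of "A - B" "B - A - {e}"] fin e d by (auto simp: d_def)
    moreover have "E' - I = (\<Union>g\<in>{0..<int p}. C g)"
      using l AB by (auto simp: C_def E'_def)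
    then have "card (E' - I) = (\<Sum>g\<in>{0..<int p}. card (C g))"
      using fin by (simp, subst card_UN_disjoint) (auto simp: C_def E'_def)
    \<comment> \<open>Since \<open>d\<close> is positive, the truncated \<open>d - 1\<close> agrees
      with the integer difference.\<close>
    ultimately have "int d + (int d - 1) = (\<Sum>g\<in>{0..<int p}. int (card (C g)))"
      using dp p0 by (simp flip: of_nat_sum)
    also have "\<dots> \<le> (\<Sum>g\<in>{0..<int p}. int (R.rk (I \<union> {x \<in> E'. l x = g})) - int (card I))"
      by (intro sum_mono rank_class)
    finally have lower: "2 * int d - 1 \<le> \<dots>" by simp
    define S where "S = (\<lambda>B. sum l (B - I) mod int p) ` {B. matroid_base indep' B \<and> I \<subseteq> B}"
    have "l ` E' \<subseteq> {0..<int p}" using l AB by (auto simp: E'_def)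
    \<comment> \<open>The bound is at least the minimum of \<open>p\<close> and
      \<open>1 + (2 * d - 1) - d = d\<close>, and \<open>p \<le> d\<close>.\<close>
    from R.base_label_sums[OF p this iI] lower rkE' d dp
    have "p \<le> card S" by (simp add: S_def)
    moreover have "S \<subseteq> {0..<int p}" using p0 by (auto simp: S_def)
    ultimately have "S = {0..<int p}" by (intro card_seteq) auto
    then have "sum l (B - I) mod int p \<in> S" using p0 by simp
    then obtain B' where B': "matroid_base indep' B'" "I \<subseteq> B'"
      "sum l (B - I) mod int p = sum l (B' - I) mod int p" by (auto simp: S_def)
    have iB': "indep B'" "B' \<subseteq> E'" and cB': "card B' = card A"
      using R.base_iff_card[THEN iffD1, OF B'(1)] rkE' by (simp_all add: indep'_def)
    then have base': "matroid_base indep B'" using A base_iff_card by simp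
    have finB': "finite B'" using iB' indep_finite by simp
    have "sum l B = sum l (B - I) + sum l I" "sum l B' = sum l (B' - I) + sum l I"
      using sum.subset_diff[of I B l] sum.subset_diff[of I B' l] B'(2) fin finB'
      by (auto simp: I_def)
    with B'(3) have "sum l B' mod int p = sum l B mod int p"
      by (metis mod_add_left_eq)
    with base' B have "good B'" by (simp add: good_def)
    then have le: "d \<le> card (A - B')" using least d_def by simp
    \<comment> \<open>\<open>B'\<close> keeps \<open>I\<close>, so minimality forces equality. Then
      \<open>B'\<close> misses both \<open>A - B\<close> and \<open>e\<close>, which leaves too few
      elements for a base.\<close>
    have "A - B' \<subseteq> A - B" using B'(2) by (auto simp: I_def)
    with le have "A - B' = A - B" using fin by (intro card_seteq) (auto simp: d_def)
    then have "B' \<subseteq> B - {e}" using iB'(2) by (auto simp: E'_def)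
    then have "card B' \<le> card (B - {e})" using fin by (intro card_mono) auto
    also have "\<dots> < card B" using fin e by (intro card_Diff1_less)
    finally show False using cB' cAB by simp
  qed
  with B show ?thesis by (auto simp: good_def)
qed

end

section \<open>Transfer to the group of residues\<close>

theorem theorem3:
  fixes p :: nat
  assumes "prime p"
  shows "k_close TYPE('e) (integer_mod_group p) (p - 1)"
  unfolding k_close_def
proof (intro allI impI)
  fix E :: "'e set" and indep l g A
  assume M: "finite_matroid E indep" and l: "l \<in> E \<rightarrow> carrier (integer_mod_group p)"
    and "\<exists>B. matroid_base indep B \<and> finprod (integer_mod_group p) l B = g"
    and A: "matroid_base indep A"
  then obtain B\<^sub>0 where B0: "matroid_base indep B\<^sub>0" "finprod (integer_mod_group p) l B\<^sub>0 = g" by blast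
  interpret finite_matroid E indep by (fact M)
  have p0: "0 < p" using assms prime_gt_0_nat by blast
  have label_sum: "finprod (integer_mod_group p) l B = sum l B mod int p"
    if "matroid_base indep B" for B
  proof -
    have "indep B" using that by (simp add: matroid_base_def)
    with l show ?thesis
      using indep_finite indep_subset_ground p0
      by (intro finprod_integer_mod_group) auto
  qed
  \<comment> \<open>Positivity of \<open>p\<close> matters: the carrier of
    \<open>integer_mod_group 0\<close> consists of all integers.\<close>
  have "l ` E \<subseteq> {0..<int p}"
    using l p0 by (auto simp: carrier_integer_mod_group)
  from exists_close_base[OF assms this A B0(1)] label_sum B0
  show "\<exists>B. matroid_base indep B \<and> finprod (integer_mod_group p) l B = g \<and> card (A - B) \<le> p - 1"
    by auto
qed

end
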